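(* Let $n\ge 2$. Then the polynomial $$h_n= \sum_{k_1=1}^n \cdots \sum_{k_n=1}^n \sum_{\sigma\in S_n}\sum_{\gamma\in S_n}\operatorname{sgn}(\sigma)\operatorname{sgn}(\gamma)\; p_{k_1 \sigma(1) k_n \gamma(1)}\; p_{k_2 \sigma(2) k_1 \gamma(2)}\cdots p_{k_n \sigma(n) k_{n-1} \gamma(n)}$$ (where the $m$-th factor is $p_{k_m\sigma(m)k_{m-1}\gamma(m)}$, with $k_0:=k_n$) vanishes on $SOT_{2,n}$; that is, for every $P=(p_{abcd})\in SOT_{2,n}$ the value of $h_n$ at the entries of $P$ is $0$.
   Context: $S_n$ in the sums is the symmetric group on $\{1,\ldots,n\}$. A symmetric tensor $T\in S^3(\mathbb R^n)$ (an $n\times n\times n$ real tensor whose entries are invariant under permuting the three indices) is called symmetrically odeco if $T=\sum_{i=1}^r\lambda_i v_i^{\otimes 3}$ for some orthonormal vectors $v_1,\ldots,v_r\in\mathbb R^n$ and scalars $\lambda_i\in\mathbb R$. $SOT_{2,n}$ denotes the set of symmetrically odeco tensor trains of length 2, i.e. the set of tensors $P=(p_{abcd})_{a,b,c,d=1}^n\in(\mathbb R^n)^{\otimes 4}$ for which there are symmetrically odeco tensors $T,S\in S^3(\mathbb R^n)$ with $p_{abcd}=\sum_{s=1}^n T_{abs}S_{scd}$ for all $a,b,c,d$. *)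

theory Defs
  imports Complex_Main "HOL-Library.FuncSet" "HOL-Combinatorics.Permutations"
begin

text \<open>
  Vectors in $R^n$ and tensors over $R^n$ are real-valued functions of natural-number
  indices, of which only the values at indices in \<open>{1..n}\<close> are significant. Every
  definition below inspects only these values.
\<close>

type_synonym tensor3 = "nat \<Rightarrow> nat \<Rightarrow> nat \<Rightarrow> real"
type_synonym tensor4 = "nat \<Rightarrow> nat \<Rightarrow> nat \<Rightarrow> nat \<Rightarrow> real"

text \<open>The two transpositions imposed below generate all permutations of the three indices.\<close>

definition symmetric_tensor3 :: "nat \<Rightarrow> tensor3 \<Rightarrow> bool" where
  "symmetric_tensor3 n T \<longleftrightarrow>
     (\<forall>a\<in>{1..n}. \<forall>b\<in>{1..n}. \<forall>c\<in>{1..n}. T a b c = T b a c \<and> T a b c = T a c b)"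

definition orthonormal_family :: "nat \<Rightarrow> nat \<Rightarrow> (nat \<Rightarrow> nat \<Rightarrow> real) \<Rightarrow> bool" where
  "orthonormal_family n r v \<longleftrightarrow>
     (\<forall>i\<in>{1..r}. \<forall>j\<in>{1..r}. (\<Sum>a=1..n. v i a * v j a) = (if i = j then 1 else 0))"

definition symmetrically_odeco :: "nat \<Rightarrow> tensor3 \<Rightarrow> bool" where
  "symmetrically_odeco n T \<longleftrightarrow>
     symmetric_tensor3 n T \<and>
     (\<exists>(r::nat) (l :: nat \<Rightarrow> real) (v :: nat \<Rightarrow> nat \<Rightarrow> real).
        orthonormal_family n r v \<and>
        (\<forall>a\<in>{1..n}. \<forall>b\<in>{1..n}. \<forall>c\<in>{1..n}.
           T a b c = (\<Sum>i=1..r. l i * (v i a * v i b * v i c))))"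

definition SOT2 :: "nat \<Rightarrow> tensor4 set" where
  "SOT2 n = {p. \<exists>T S. symmetrically_odeco n T \<and> symmetrically_odeco n S \<and>
     (\<forall>a\<in>{1..n}. \<forall>b\<in>{1..n}. \<forall>c\<in>{1..n}. \<forall>d\<in>{1..n}.
        p a b c d = (\<Sum>s=1..n. T a b s * S s c d))}"

definition cyc_pred :: "nat \<Rightarrow> nat \<Rightarrow> nat" where
  "cyc_pred n m = (if m = 1 then n else m - 1)"

text \<open>
  The value of the polynomial $h_n$ at the entries of \<open>p\<close>. The iterated sum over
  $k_1, ..., k_n$ is a single sum over all functions \<open>k\<close> from \<open>{1..n}\<close> to itself
  (extensional, so that each function is counted once).
\<close>

definition h_poly :: "nat \<Rightarrow> tensor4 \<Rightarrow> real" where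
  "h_poly n p =
     (\<Sum>k \<in> {1..n} \<rightarrow>\<^sub>E {1..n}.
        \<Sum>\<sigma> | \<sigma> permutes {1..n}. \<Sum>\<gamma> | \<gamma> permutes {1..n}.
          of_int (sign \<sigma>) * of_int (sign \<gamma>) *
          (\<Prod>m=1..n. p (k m) (\<sigma> m) (k (cyc_pred n m)) (\<gamma> m)))"

end

theory Submission
  imports Defs
begin

text \<open>
  Write \<open>S\<close> as the sum of \<open>\<mu>\<^sub>i w\<^sub>i \<otimes> w\<^sub>i \<otimes> w\<^sub>i\<close>, expand the product in \<open>h\<^sub>n\<close> over maps \<open>j\<close> on
  \<open>{1..n}\<close>, and carry out the sum over \<open>k\<close>. What remains is a sum over \<open>j\<close> of multiples of
  \<open>det (u\<^sub>m) det (x\<^sub>m)\<close>, where \<open>u\<^sub>m = w (j m)\<close> and \<open>x\<^sub>m = T (u\<^sub>m, u\<^sub>m\<^sub>+\<^sub>1, \<cdot>)\<close> with cyclic indices.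
  The first determinant vanishes unless \<open>j\<close> is injective, and then, as \<open>n \<ge> 2\<close>, the vectors
  \<open>u\<^sub>m\<close> and \<open>u\<^sub>m\<^sub>+\<^sub>1\<close> are orthogonal. But for odeco \<open>T\<close> there is a nonzero \<open>y\<close> with
  \<open>T (u, u', y) = 0\<close> for all orthogonal \<open>u, u'\<close>, so the second determinant vanishes. If
  \<open>T\<close> is the sum of \<open>l\<^sub>i v\<^sub>i \<otimes> v\<^sub>i \<otimes> v\<^sub>i\<close> with all \<open>l\<^sub>i\<close> nonzero and \<open>v\<close> an orthonormal basis, take
  \<open>y\<close> to be the sum of \<open>v\<^sub>i / l\<^sub>i\<close>, so that \<open>T (u, u', y)\<close> is the inner product of \<open>u\<close> and \<open>u'\<close>;
  otherwise some nonzero \<open>y\<close> is orthogonal to every \<open>v\<^sub>i\<close> with \<open>l\<^sub>i\<close> nonzero.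
\<close>

section \<open>Determinants through the Leibniz formula\<close>

definition leibniz_det :: "'a set \<Rightarrow> ('a \<Rightarrow> 'a \<Rightarrow> real) \<Rightarrow> real" where
  "leibniz_det A M = (\<Sum>\<sigma> | \<sigma> permutes A. of_int (sign \<sigma>) * (\<Prod>m\<in>A. M m (\<sigma> m)))"

lemma leibniz_det_transpose:
  assumes "finite A"
  shows "leibniz_det A (\<lambda>a b. M b a) = leibniz_det A M"
proof -
  have "leibniz_det A (\<lambda>a b. M b a)
      = (\<Sum>\<sigma> | \<sigma> permutes A. of_int (sign (inv \<sigma>)) * (\<Prod>m\<in>A. M (inv \<sigma> m) m))"
    unfolding leibniz_det_def by (rule sum_permutations_inverse)
  also have "\<dots> = leibniz_det A M"
    unfolding leibniz_det_def
  proof (rule sum.cong[OF refl], clarify)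
    fix \<sigma> assume \<sigma>: "\<sigma> permutes A"
    have "(\<Prod>m\<in>A. M (inv \<sigma> m) m) = (\<Prod>m\<in>A. M (inv \<sigma> (\<sigma> m)) (\<sigma> m))"
      using prod.permute[OF \<sigma>, of "\<lambda>m. M (inv \<sigma> m) m"] by simp
    moreover have "sign (inv \<sigma>) = sign \<sigma>"
      using \<sigma> assms by (meson permutation_permutes sign_inverse)
    ultimately show "of_int (sign (inv \<sigma>)) * (\<Prod>m\<in>A. M (inv \<sigma> m) m)
        = of_int (sign \<sigma>) * (\<Prod>m\<in>A. M m (\<sigma> m))"
      using permutes_inverses(2)[OF \<sigma>] by simp
  qed
  finally show ?thesis .
qed

text \<open>Composing \<sigma> with the transposition of \<open>i\<close> and \<open>j\<close> flips
  its sign and keeps the product, so the determinant equals its own negative.\<close>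

lemma leibniz_det_equal_rows:
  assumes fin: "finite A" and i: "i \<in> A" and j: "j \<in> A" and "i \<noteq> j"
    and eq: "\<And>c. c \<in> A \<Longrightarrow> M i c = M j c"
  shows "leibniz_det A M = 0"
proof -
  let ?t = "transpose i j"
  have t: "?t permutes A" using i j by (rule permutes_swap_id)
  have "leibniz_det A M
      = (\<Sum>\<sigma> | \<sigma> permutes A. of_int (sign (\<sigma> \<circ> ?t)) * (\<Prod>m\<in>A. M m ((\<sigma> \<circ> ?t) m)))"
    unfolding leibniz_det_def by (rule sum_permutations_compose_right[OF t])
  also have "\<dots> = (\<Sum>\<sigma> | \<sigma> permutes A. - (of_int (sign \<sigma>) * (\<Prod>m\<in>A. M m (\<sigma> m))))"
  proof (rule sum.cong[OF refl], clarify)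
    fix \<sigma> assume \<sigma>: "\<sigma> permutes A"
    have "permutation \<sigma>" using \<sigma> fin permutation_permutes by blast
    then have "sign (\<sigma> \<circ> ?t) = - sign \<sigma>"
      using \<open>i \<noteq> j\<close> by (simp add: sign_compose permutation_swap_id sign_swap_id)
    moreover have "(\<Prod>m\<in>A. M m ((\<sigma> \<circ> ?t) m)) = (\<Prod>m\<in>A. M (?t m) (\<sigma> m))"
      by (subst prod.permute[OF t]) (simp add: o_def)
    moreover have "\<dots> = (\<Prod>m\<in>A. M m (\<sigma> m))"
      by (rule prod.cong) (auto simp: transpose_def eq permutes_in_image[OF \<sigma>])
    ultimately show "of_int (sign (\<sigma> \<circ> ?t)) * (\<Prod>m\<in>A. M m ((\<sigma> \<circ> ?t) m))
        = - (of_int (sign \<sigma>) * (\<Prod>m\<in>A. M m (\<sigma> m)))" by simp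
  qed
  also have "\<dots> = - leibniz_det A M"
    by (simp add: leibniz_det_def sum_negf)
  finally show ?thesis by simp
qed

text \<open>Replacing row \<open>b\<close> by the vanishing combination of all rows gives 0.
  Linearity in row \<open>b\<close> splits this into \<open>y a\<close> times the determinant of
  \<open>?N a\<close>; for \<open>a\<close> other than \<open>b\<close> two rows agree, so only
  \<open>y b\<close> times the determinant of \<open>M\<close> is left.\<close>

lemma leibniz_det_dependent_rows:
  assumes fin: "finite A" and b: "b \<in> A" and y: "y b \<noteq> 0"
    and dep: "\<And>c. c \<in> A \<Longrightarrow> (\<Sum>a\<in>A. y a * M a c) = 0"
  shows "leibniz_det A M = 0"
proof -
  let ?N = "\<lambda>a. M(b := M a)"
  have "(\<Sum>a\<in>A. y a * leibniz_det A (?N a))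
      = (\<Sum>a\<in>A. \<Sum>\<sigma> | \<sigma> permutes A. of_int (sign \<sigma>) * (\<Prod>m\<in>A-{b}. M m (\<sigma> m)) * (y a * M a (\<sigma> b)))"
    unfolding leibniz_det_def sum_distrib_left
    by (intro sum.cong refl) (simp add: prod.remove[OF fin b] mult_ac)
  also have "\<dots> = (\<Sum>\<sigma> | \<sigma> permutes A. of_int (sign \<sigma>) * (\<Prod>m\<in>A-{b}. M m (\<sigma> m)) * (\<Sum>a\<in>A. y a * M a (\<sigma> b)))"
    by (subst sum.swap) (simp add: sum_distrib_left)
  also have "\<dots> = 0"
    by (rule sum.neutral) (auto simp: dep b permutes_in_image)
  finally have "(\<Sum>a\<in>A. y a * leibniz_det A (?N a)) = 0" .
  moreover have "leibniz_det A (?N a) = 0" if "a \<in> A - {b}" for a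
    using that b by (intro leibniz_det_equal_rows[OF fin, of a b]) auto
  ultimately have "y b * leibniz_det A (?N b) = 0"
    by (simp add: sum.remove[OF fin b])
  with y show ?thesis by simp
qed

section \<open>Odeco tensors contracted with orthogonal vectors\<close>

lemma orthonormal_familyD:
  assumes "orthonormal_family n r v" "i \<in> {1..r}" "j \<in> {1..r}"
  shows "(\<Sum>a=1..n. v i a * v j a) = (if i = j then 1 else 0)"
  using assms unfolding orthonormal_family_def by blast

definition pairing :: "nat \<Rightarrow> (nat \<Rightarrow> real) \<Rightarrow> (nat \<Rightarrow> real) \<Rightarrow> real" where
  "pairing n u w = (\<Sum>a=1..n. u a * w a)"

lemma pairing_commute: "pairing n u w = pairing n w u"
  by (simp add: pairing_def mult.commute)

lemma pairing_sum_right: "pairing n u (\<lambda>b. \<Sum>i\<in>J. c i * w i b) = (\<Sum>i\<in>J. c i * pairing n u (w i))"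
  unfolding pairing_def sum_distrib_left by (subst sum.swap) (simp add: mult_ac)

lemma pairing_sum_left: "pairing n (\<lambda>b. \<Sum>i\<in>J. c i * w i b) u = (\<Sum>i\<in>J. c i * pairing n (w i) u)"
  using pairing_sum_right by (simp add: pairing_commute)

text \<open>The sum is T(u, w, y). One \<open>y\<close> serves all orthogonal pairs, so it gives a
  single linear relation valid for every x_m at once.\<close>

lemma odeco_annihilator:
  fixes l :: "nat \<Rightarrow> real" and v :: "nat \<Rightarrow> nat \<Rightarrow> real"
  assumes on: "orthonormal_family n r v" and n: "n \<ge> 1"
  obtains b y where "b \<in> {1..n}" "y b \<noteq> 0"
    "\<And>u w. pairing n u w = 0 \<Longrightarrow>
       (\<Sum>i=1..r. l i * pairing n (v i) u * pairing n (v i) w * pairing n y (v i)) = 0"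
proof -
  have on': "pairing n (v i) (v j) = (if i = j then 1 else 0)" if "i \<in> {1..r}" "j \<in> {1..r}" for i j
    using orthonormal_familyD[OF on that] by (simp add: pairing_def)
  define e where "e a b = (if a = b then 1 else 0 :: real)" for a b :: nat
  have pe: "pairing n (e a) u = u a" "pairing n u (e a) = u a" if "a \<in> {1..n}" for a u
    using that by (auto simp: pairing_def e_def if_distrib[of "\<lambda>x. x * _"] if_distrib[of "\<lambda>x. _ * x"] cong: if_cong)
  \<comment> \<open>\<open>q\<close> is the matrix of the orthogonal projection onto the span of the
    \<open>v i\<close>; it is the identity exactly when they form a basis.\<close>
  define q where "q a b = (\<Sum>i=1..r. v i a * v i b)" for a b
  consider (incomplete) a b where "a \<in> {1..n}" "b \<in> {1..n}" "q a b \<noteq> e a b"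
    | (zero) i where "i \<in> {1..r}" "l i = 0"
    | (basis) "\<And>a b. a \<in> {1..n} \<Longrightarrow> b \<in> {1..n} \<Longrightarrow> q a b = e a b"
        "\<And>i. i \<in> {1..r} \<Longrightarrow> l i \<noteq> 0"
    by blast
  then show thesis
  proof cases
    case incomplete
    \<comment> \<open>This is the part of \<open>e a\<close> orthogonal to every \<open>v i\<close>;
      its entry at \<open>b\<close> is nonzero by the choice of \<open>a\<close> and
      \<open>b\<close>.\<close>
    define y where "y c = e a c - q a c" for c
    have "pairing n y (v i) = 0" if i: "i \<in> {1..r}" for i
    proof -
      have "pairing n y (v i) = pairing n (e a) (v i) - pairing n (q a) (v i)"
        by (simp add: pairing_def y_def left_diff_distrib sum_subtractf)
      also have "pairing n (q a) (v i) = (\<Sum>j=1..r. v j a * pairing n (v j) (v i))"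
        unfolding q_def by (rule pairing_sum_left)
      also have "\<dots> = v i a"
        using i by (simp add: on' if_distrib[of "\<lambda>x. _ * x"] cong: if_cong)
      finally show ?thesis using incomplete by (simp add: pe)
    qed
    then show thesis using incomplete by (intro that[of b y]) (auto simp: y_def)
  next
    case zero
    have "pairing n (v i) (v i) \<noteq> 0" using on' zero by simp
    then obtain b where b: "b \<in> {1..n}" "v i b \<noteq> 0"
      unfolding pairing_def by (metis (no_types, lifting) mult_zero_left sum.neutral)
    \<comment> \<open>With \<open>v i\<close> as \<open>y\<close>, orthonormality kills every term
      except the one at \<open>i\<close>, where \<open>l i\<close> is 0.\<close>
    show thesis
    proof (rule that[of b "v i"])
      fix u w
      show "(\<Sum>j=1..r. l j * pairing n (v j) u * pairing n (v j) w * pairing n (v i) (v j)) = 0"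
        using zero by (intro sum.neutral ballI) (auto simp: on')
    qed (use b in auto)
  next
    case basis
    define y where "y c = (\<Sum>i=1..r. (1 / l i) * v i c)" for c
    have yv: "pairing n y (v i) = 1 / l i" if i: "i \<in> {1..r}" for i
      using i by (simp add: y_def[abs_def] pairing_sum_left on' if_distrib[of "\<lambda>x. _ * x"] cong: if_cong del: times_divide_eq_left)
    \<comment> \<open>An empty family would make \<open>q\<close> zero instead of the identity;
      hence \<open>v 1\<close> exists, and pairing with it shows that \<open>y\<close> is
      nonzero.\<close>
    have "r \<ge> 1"
    proof (rule ccontr)
      assume "\<not> r \<ge> 1"
      then have "q 1 1 = 0" by (simp add: q_def)
      with basis(1)[of 1 1] n show False by (simp add: e_def)
    qed
    with yv[of 1] basis(2)[of 1] have "pairing n y (v 1) \<noteq> 0" by simp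
    then obtain b where b: "b \<in> {1..n}" "y b \<noteq> 0"
      unfolding pairing_def by (metis (no_types, lifting) mult_zero_left sum.neutral)
    show thesis
    proof (rule that[of b y])
      fix u w assume uw: "pairing n u w = 0"
      \<comment> \<open>The factor \<open>1 / l i\<close> from \<open>y\<close> cancels
        \<open>l i\<close>; what remains is Parseval's identity, which follows from \<open>q\<close>
        being the identity.\<close>
      have "(\<Sum>i=1..r. l i * pairing n (v i) u * pairing n (v i) w * pairing n y (v i))
          = (\<Sum>i=1..r. pairing n (v i) u * pairing n (v i) w)"
        using basis(2) by (intro sum.cong refl) (simp add: yv)
      also have "\<dots> = (\<Sum>i=1..r. \<Sum>a=1..n. \<Sum>b=1..n. u a * w b * (v i a * v i b))"
        by (simp add: pairing_def sum_product mult_ac)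
      also have "\<dots> = (\<Sum>a=1..n. \<Sum>i=1..r. \<Sum>b=1..n. u a * w b * (v i a * v i b))"
        by (rule sum.swap)
      also have "\<dots> = (\<Sum>a=1..n. \<Sum>b=1..n. \<Sum>i=1..r. u a * w b * (v i a * v i b))"
        by (intro sum.cong refl sum.swap)
      also have "\<dots> = (\<Sum>a=1..n. \<Sum>b=1..n. u a * w b * e a b)"
        by (intro sum.cong refl) (simp only: sum_distrib_left[symmetric] q_def[symmetric] basis(1))
      also have "\<dots> = (\<Sum>a=1..n. u a * pairing n w (e a))"
        by (simp add: pairing_def sum_distrib_left mult_ac)
      also have "\<dots> = pairing n u w"
        by (simp add: pe, simp add: pairing_def)
      finally show "(\<Sum>i=1..r. l i * pairing n (v i) u * pairing n (v i) w * pairing n y (v i)) = 0"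
        using uw by simp
    qed (use b in auto)
  qed
qed

section \<open>Expansion of the polynomial into products of two determinants\<close>

definition cyc_succ :: "nat \<Rightarrow> nat \<Rightarrow> nat" where
  "cyc_succ n m = (if m = n then 1 else m + 1)"

lemma bij_betw_cyc_succ: "bij_betw (cyc_succ n) {1..n} {1..n}"
  by (rule bij_betw_byWitness[where f' = "cyc_pred n"])
     (auto simp: cyc_succ_def cyc_pred_def)

text \<open>The index \<open>k m\<close> occurs with \<open>F\<close> in factor \<open>m\<close> and
  with \<open>G\<close> in factor \<open>cyc_succ n m\<close>. Reindexing brings the two together,
  and the sum over all \<open>k\<close> then factors by distributivity.\<close>

lemma sum_cyclic_contraction:
  fixes F G :: "nat \<Rightarrow> nat \<Rightarrow> real"
  shows "(\<Sum>k \<in> {1..n} \<rightarrow>\<^sub>E {1..n}. \<Prod>m=1..n. F m (k m) * G m (k (cyc_pred n m)))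
    = (\<Prod>m=1..n. \<Sum>a=1..n. F m a * G (cyc_succ n m) a)"
proof -
  have "(\<Prod>m=1..n. G m (k (cyc_pred n m))) = (\<Prod>m=1..n. G (cyc_succ n m) (k m))" for k
    by (subst prod.reindex_bij_betw[OF bij_betw_cyc_succ, symmetric])
       (auto intro!: prod.cong simp: cyc_succ_def cyc_pred_def)
  then have "(\<Prod>m=1..n. F m (k m) * G m (k (cyc_pred n m)))
      = (\<Prod>m=1..n. F m (k m) * G (cyc_succ n m) (k m))" for k
    by (simp only: prod.distrib)
  then show ?thesis
    by (simp only:) (rule prod_sum_PiE[symmetric], auto)
qed

text \<open>For fixed \<open>j\<close>, the sum over \<gamma> meets only the factors
  \<open>w (j m) (\<gamma> m)\<close> and gives the first determinant. Contracting every
  \<open>k m\<close> in the other factors turns the sum over \<sigma> into the second.\<close>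

lemma h_poly_expansion:
  fixes \<mu> :: "nat \<Rightarrow> real"
  assumes p: "\<And>a b c d. \<lbrakk>a \<in> {1..n}; b \<in> {1..n}; c \<in> {1..n}; d \<in> {1..n}\<rbrakk> \<Longrightarrow>
      p a b c d = (\<Sum>j=1..r. \<mu> j * B j a b * w j c * w j d)"
  shows "h_poly n p = (\<Sum>j \<in> {1..n} \<rightarrow>\<^sub>E {1..r}. (\<Prod>m=1..n. \<mu> (j m)) *
      leibniz_det {1..n} (\<lambda>m. w (j m)) *
      leibniz_det {1..n} (\<lambda>m b. \<Sum>a=1..n. B (j m) a b * w (j (cyc_succ n m)) a))"
proof -
  let ?I = "{1..n}" and ?J = "{1..n} \<rightarrow>\<^sub>E {1..r}" and ?K = "{1..n} \<rightarrow>\<^sub>E {1..n}"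
  let ?P = "{\<sigma>. \<sigma> permutes {1..n}}"
  let ?s = "\<lambda>\<sigma>::nat\<Rightarrow>nat. real_of_int (sign \<sigma>)"
  let ?g = "\<lambda>j k \<sigma>. \<Prod>m\<in>?I. B (j m) (k m) (\<sigma> m) * w (j m) (k (cyc_pred n m))"
  let ?c = "\<lambda>j. \<Prod>m\<in>?I. \<mu> (j m)"
  let ?d = "\<lambda>j \<gamma>. ?s \<gamma> * (\<Prod>m\<in>?I. w (j m) (\<gamma> m))"
  have "h_poly n p = (\<Sum>k\<in>?K. \<Sum>\<sigma>\<in>?P. \<Sum>\<gamma>\<in>?P. \<Sum>j\<in>?J. ?c j * ?d j \<gamma> * (?s \<sigma> * ?g j k \<sigma>))"
    unfolding h_poly_def
  proof (intro sum.cong refl)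
    fix k \<sigma> \<gamma> assume k: "k \<in> ?K" and \<sigma>: "\<sigma> \<in> ?P" and \<gamma>: "\<gamma> \<in> ?P"
    have "(\<Prod>m\<in>?I. p (k m) (\<sigma> m) (k (cyc_pred n m)) (\<gamma> m))
       = (\<Prod>m\<in>?I. \<Sum>j=1..r. \<mu> j * B j (k m) (\<sigma> m) * w j (k (cyc_pred n m)) * w j (\<gamma> m))"
    proof (rule prod.cong[OF refl], rule p)
      fix m assume m: "m \<in> ?I"
      have c: "cyc_pred n m \<in> ?I" using m by (auto simp: cyc_pred_def)
      show "k m \<in> ?I" by (rule PiE_mem[OF k m])
      show "k (cyc_pred n m) \<in> ?I" by (rule PiE_mem[OF k c])
      show "\<sigma> m \<in> ?I" "\<gamma> m \<in> ?I" using \<sigma> \<gamma> m by (auto simp only: mem_Collect_eq permutes_in_image)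
    qed
    also have "\<dots> = (\<Sum>j\<in>?J. \<Prod>m\<in>?I. \<mu> (j m) * B (j m) (k m) (\<sigma> m) * w (j m) (k (cyc_pred n m)) * w (j m) (\<gamma> m))"
      by (rule prod_sum_PiE) auto
    finally show "?s \<sigma> * ?s \<gamma> * (\<Prod>m\<in>?I. p (k m) (\<sigma> m) (k (cyc_pred n m)) (\<gamma> m))
       = (\<Sum>j\<in>?J. ?c j * ?d j \<gamma> * (?s \<sigma> * ?g j k \<sigma>))"
      by (simp add: sum_distrib_left prod.distrib mult_ac)
  qed
  \<comment> \<open>The sum over \<open>j\<close> moves outermost and the one over \<open>k\<close>
    inside the one over \<sigma>, so that the sums over \<gamma> and \<sigma> separate.\<close>
  also have "\<dots> = (\<Sum>k\<in>?K. \<Sum>\<sigma>\<in>?P. \<Sum>j\<in>?J. \<Sum>\<gamma>\<in>?P. ?c j * ?d j \<gamma> * (?s \<sigma> * ?g j k \<sigma>))"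
    by (intro sum.cong refl sum.swap)
  also have "\<dots> = (\<Sum>k\<in>?K. \<Sum>j\<in>?J. \<Sum>\<sigma>\<in>?P. \<Sum>\<gamma>\<in>?P. ?c j * ?d j \<gamma> * (?s \<sigma> * ?g j k \<sigma>))"
    by (intro sum.cong refl sum.swap)
  also have "\<dots> = (\<Sum>j\<in>?J. \<Sum>k\<in>?K. \<Sum>\<sigma>\<in>?P. \<Sum>\<gamma>\<in>?P. ?c j * ?d j \<gamma> * (?s \<sigma> * ?g j k \<sigma>))"
    by (rule sum.swap)
  also have "\<dots> = (\<Sum>j\<in>?J. \<Sum>\<sigma>\<in>?P. \<Sum>k\<in>?K. \<Sum>\<gamma>\<in>?P. ?c j * ?d j \<gamma> * (?s \<sigma> * ?g j k \<sigma>))"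
    by (intro sum.cong refl sum.swap)
  also have "\<dots> = (\<Sum>j\<in>?J. ?c j * (\<Sum>\<gamma>\<in>?P. ?d j \<gamma>) * (\<Sum>\<sigma>\<in>?P. ?s \<sigma> * (\<Sum>k\<in>?K. ?g j k \<sigma>)))"
    by (simp only: sum_distrib_left[symmetric] sum_distrib_right[symmetric])
  also have "\<dots> = (\<Sum>j\<in>?J. ?c j * leibniz_det ?I (\<lambda>m. w (j m)) *
      leibniz_det ?I (\<lambda>m b. \<Sum>a=1..n. B (j m) a b * w (j (cyc_succ n m)) a))"
    unfolding leibniz_det_def
    using sum_cyclic_contraction[where F = "\<lambda>m a. B (_ m) a (_ m)" and G = "\<lambda>m. w (_ m)"]
    by (intro sum.cong refl arg_cong2[where f = "(*)"]) auto
  finally show ?thesis .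
qed

section \<open>Vanishing on tensor trains of length 2\<close>

theorem theorem8:
  fixes n :: nat and p :: tensor4
  assumes "n \<ge> 2" and "p \<in> SOT2 n"
  shows "h_poly n p = 0"
proof -
  obtain T S where odT: "symmetrically_odeco n T" and odS: "symmetrically_odeco n S"
    and p: "\<And>a b c d. \<lbrakk>a \<in> {1..n}; b \<in> {1..n}; c \<in> {1..n}; d \<in> {1..n}\<rbrakk> \<Longrightarrow>
        p a b c d = (\<Sum>s=1..n. T a b s * S s c d)"
    using assms(2) unfolding SOT2_def by blast
  obtain r l v where v: "orthonormal_family n r v"
    and T: "\<And>a b c. \<lbrakk>a \<in> {1..n}; b \<in> {1..n}; c \<in> {1..n}\<rbrakk> \<Longrightarrow>
        T a b c = (\<Sum>i=1..r. l i * (v i a * v i b * v i c))"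
    using odT unfolding symmetrically_odeco_def by blast
  obtain r' \<mu> w where w: "orthonormal_family n r' w"
    and S: "\<And>a b c. \<lbrakk>a \<in> {1..n}; b \<in> {1..n}; c \<in> {1..n}\<rbrakk> \<Longrightarrow>
        S a b c = (\<Sum>i=1..r'. \<mu> i * (w i a * w i b * w i c))"
    using odS unfolding symmetrically_odeco_def by blast
  let ?I = "{1..n}"
  \<comment> \<open>\<open>B j\<close> is T with \<open>w j\<close> contracted into one slot,
    expanded in the \<open>v i\<close>.\<close>
  define B where "B j a b = (\<Sum>i=1..r. l i * pairing n (v i) (w j) * v i b * v i a)" for j a b
  have pB: "p a b c d = (\<Sum>j=1..r'. \<mu> j * B j a b * w j c * w j d)"
    if "a \<in> ?I" "b \<in> ?I" "c \<in> ?I" "d \<in> ?I" for a b c d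
  proof -
    have "p a b c d = (\<Sum>s=1..n. \<Sum>j=1..r'. T a b s * (\<mu> j * (w j s * w j c * w j d)))"
      using that by (simp add: p S sum_distrib_left)
    also have "\<dots> = (\<Sum>j=1..r'. \<Sum>s=1..n. T a b s * (\<mu> j * (w j s * w j c * w j d)))"
      by (rule sum.swap)
    also have "\<dots> = (\<Sum>j=1..r'. \<mu> j * (\<Sum>s=1..n. T a b s * w j s) * w j c * w j d)"
      by (simp add: sum_distrib_left sum_distrib_right mult_ac)
    also have "\<dots> = (\<Sum>j=1..r'. \<mu> j * B j a b * w j c * w j d)"
    proof (rule sum.cong[OF refl])
      fix j
      have "(\<Sum>s=1..n. T a b s * w j s) = (\<Sum>s=1..n. \<Sum>i=1..r. l i * (v i a * v i b * v i s) * w j s)"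
        using that by (simp add: T sum_distrib_right)
      also have "\<dots> = B j a b"
        unfolding B_def pairing_def
        by (subst sum.swap) (simp add: sum_distrib_left sum_distrib_right mult_ac)
      finally show "\<mu> j * (\<Sum>s=1..n. T a b s * w j s) * w j c * w j d = \<mu> j * B j a b * w j c * w j d"
        by simp
    qed
    finally show ?thesis .
  qed
  have n1: "n \<ge> 1" using assms(1) by simp
  obtain b y where b: "b \<in> ?I" "y b \<noteq> 0"
    and y: "\<And>u w. pairing n u w = 0 \<Longrightarrow>
       (\<Sum>i=1..r. l i * pairing n (v i) u * pairing n (v i) w * pairing n y (v i)) = 0"
    by (rule odeco_annihilator[OF v n1, where l = l]) (rule that; simp)
  have "leibniz_det ?I (\<lambda>m. w (j m)) = 0 \<or>
      leibniz_det ?I (\<lambda>m b. \<Sum>a=1..n. B (j m) a b * w (j (cyc_succ n m)) a) = 0"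
    if j: "j \<in> ?I \<rightarrow>\<^sub>E {1..r'}" for j
  proof (cases "inj_on j ?I")
    case False
    then obtain m m' where "m \<in> ?I" "m' \<in> ?I" "m \<noteq> m'" "j m = j m'"
      unfolding inj_on_def by blast
    then have "leibniz_det ?I (\<lambda>m. w (j m)) = 0"
      by (intro leibniz_det_equal_rows[of _ m m']) auto
    then show ?thesis ..
  next
    case True
    \<comment> \<open>\<open>X m\<close> is the vector x_m, row \<open>m\<close> of the second
      matrix.\<close>
    define X where "X m b = (\<Sum>a=1..n. B (j m) a b * w (j (cyc_succ n m)) a)" for m b
    have X: "X m = (\<lambda>b. \<Sum>i=1..r. l i * pairing n (v i) (w (j m)) * pairing n (v i) (w (j (cyc_succ n m))) * v i b)" for m
    proof
      fix b
      have "X m b = (\<Sum>a=1..n. \<Sum>i=1..r. l i * pairing n (v i) (w (j m)) * v i b * (v i a * w (j (cyc_succ n m)) a))"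
        unfolding X_def B_def by (simp add: sum_distrib_left sum_distrib_right mult_ac)
      also have "\<dots> = (\<Sum>i=1..r. l i * pairing n (v i) (w (j m)) * v i b * pairing n (v i) (w (j (cyc_succ n m))))"
        unfolding pairing_def[of n _ "w (j (cyc_succ n m))"] by (subst sum.swap) (simp add: sum_distrib_left)
      finally show "X m b = (\<Sum>i=1..r. l i * pairing n (v i) (w (j m)) * pairing n (v i) (w (j (cyc_succ n m))) * v i b)"
        by (simp add: mult_ac)
    qed
    have "(\<Sum>a\<in>?I. y a * X m a) = 0" if m: "m \<in> ?I" for m
    proof -
      \<comment> \<open>Only for \<open>n = 1\<close> does \<open>cyc_succ\<close> have a fixed
        point in \<open>{1..n}\<close>.\<close>
      have s: "cyc_succ n m \<in> ?I" "cyc_succ n m \<noteq> m"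
        using m assms(1) by (auto simp: cyc_succ_def)
      have "j m \<noteq> j (cyc_succ n m)" using True m s by (metis inj_onD)
      then have "pairing n (w (j m)) (w (j (cyc_succ n m))) = 0"
        using orthonormal_familyD[OF w PiE_mem[OF j m] PiE_mem[OF j s(1)]]
        by (simp add: pairing_def)
      from y[OF this] have "pairing n y (X m) = 0"
        unfolding X pairing_sum_right .
      then show ?thesis by (simp add: pairing_def)
    qed
    \<comment> \<open>The entries of \<open>y\<close> are coefficients of a relation between the
      columns of \<open>X\<close>, hence the transpose.\<close>
    then have "leibniz_det ?I (\<lambda>a m. X m a) = 0"
      using b by (intro leibniz_det_dependent_rows[of _ b y]) auto
    then have "leibniz_det ?I X = 0"
      using leibniz_det_transpose[of ?I X, OF finite_atLeastAtMost] by argo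
    then show ?thesis by (simp add: X_def[abs_def])
  qed
  then show ?thesis
    by (subst h_poly_expansion[OF pB]) (auto intro!: sum.neutral)
qed

end
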